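(* The system $$\frac{dx}{dt}=y-3x,\qquad \frac{dy}{dt}=-xz+x-3y,\qquad \frac{dz}{dt}=xy-6z$$ has $I:=e^{6t}(x^2-2z)$ as its first integral.
   Context: A first integral is a function of $(x,y,z,t)$ which is constant in $t$ along every solution of the system. *)

theory Defs
  imports "HOL-Analysis.Analysis"
begin

text \<open>Solutions live on arbitrary real intervals (open or not, bounded or not, not necessarily
  maximal); at an endpoint belonging to the interval the derivative is one-sided.\<close>

definition solution_on ::
    "('a::real_normed_vector \<Rightarrow> 'a) \<Rightarrow> real set \<Rightarrow> (real \<Rightarrow> 'a) \<Rightarrow> bool" where
  "solution_on F J u \<longleftrightarrow>
     is_interval J \<and> (\<forall>t\<in>J. (u has_vector_derivative F (u t)) (at t within J))"

definition first_integral ::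
    "('a::real_normed_vector \<Rightarrow> 'a) \<Rightarrow> ('a \<Rightarrow> real \<Rightarrow> real) \<Rightarrow> bool" where
  "first_integral F I \<longleftrightarrow>
     (\<forall>J u. solution_on F J u \<longrightarrow> (\<lambda>t. I (u t) t) constant_on J)"

end

theory Submission
  imports Defs
begin

text \<open>Write \<open>w = x\<^sup>2 - 2 * z\<close>. Along a solution, \<open>2 * x * x'\<close> and \<open>- 2 * z'\<close> contribute the terms
  \<open>2 * x * y\<close> and \<open>- 2 * x * y\<close>, which cancel; what is left is the linear equation \<open>w' = - 6 * w\<close>.
  Hence \<open>exp (6 * t) * w\<close> has derivative zero, and a function with zero derivative on an interval
  is constant there (\<open>first_integralI\<close>).\<close>

text \<open>An interval of reals is convex, so the mean value theorem applies on it; derivatives within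
  the interval suffice, which covers the one-sided derivatives at its endpoints.\<close>

lemma first_integralI:
  assumes "\<And>J u t. \<lbrakk>solution_on F J u; t \<in> J\<rbrakk> \<Longrightarrow>
    ((\<lambda>s. I (u s) s) has_real_derivative 0) (at t within J)"
  shows "first_integral F I"
  unfolding first_integral_def
proof (intro allI impI)
  fix J u
  assume sol: "solution_on F J u"
  then have "convex J"
    by (simp add: solution_on_def is_interval_convex_1)
  then have "\<exists>c. \<forall>t\<in>J. I (u t) t = c"
    using assms[OF sol] by (intro has_field_derivative_zero_constant) auto
  then show "(\<lambda>t. I (u t) t) constant_on J"
    by (simp add: constant_on_def)
qed

theorem proposition6p1:
  "first_integral
     (\<lambda>(x::real, y::real, z::real). (y - 3 * x, - x * z + x - 3 * y, x * y - 6 * z))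
     (\<lambda>(x, y, z) t. exp (6 * t) * (x\<^sup>2 - 2 * z))"
proof (rule first_integralI)
  fix J and u :: "real \<Rightarrow> real \<times> real \<times> real" and t
  assume sol: "solution_on
      (\<lambda>(x, y, z). (y - 3 * x, - x * z + x - 3 * y, x * y - 6 * z)) J u"
    and t: "t \<in> J"
  define x y z where "x s = fst (u s)" and "y s = fst (snd (u s))" and "z s = snd (snd (u s))" for s
  have u: "u s = (x s, y s, z s)" for s
    by (simp add: x_def y_def z_def)
  have du: "(u has_vector_derivative
      (y t - 3 * x t, - x t * z t + x t - 3 * y t, x t * y t - 6 * z t)) (at t within J)"
    using sol t by (auto simp: solution_on_def u)
  have dx: "(x has_real_derivative y t - 3 * x t) (at t within J)"
    using bounded_linear.has_vector_derivative[OF bounded_linear_fst du]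
    by (simp add: has_real_derivative_iff_has_vector_derivative x_def[abs_def])
  have dz: "(z has_real_derivative x t * y t - 6 * z t) (at t within J)"
    using bounded_linear.has_vector_derivative[OF bounded_linear_snd
        bounded_linear.has_vector_derivative[OF bounded_linear_snd du]]
    by (simp add: has_real_derivative_iff_has_vector_derivative z_def[abs_def])
  have "((\<lambda>s. exp (6 * s) * ((x s)\<^sup>2 - 2 * z s)) has_real_derivative 0) (at t within J)"
    by (auto intro!: derivative_eq_intros dx dz simp: algebra_simps power2_eq_square)
  then show "((\<lambda>s. (case u s of (x, y, z) \<Rightarrow> \<lambda>t. exp (6 * t) * (x\<^sup>2 - 2 * z)) s)
      has_real_derivative 0) (at t within J)"
    by (simp add: u)
qed

end
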